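(* Let $\alpha>0$ and consider four particles of mass $1$ in $\mathbb{R}^2$ moving according to $\ddot q_i=\partial U/\partial q_i$, $i=1,2,3,4$, with the $\alpha$-homogeneous potential $U(q_1,\dots,q_4)=\sum_{1\le i<j\le 4}\|q_i-q_j\|^{-\alpha}$. Let $z_0=(1,0,0,1,-1,0,0,-1)^T\in\mathbb{R}^8$ be the vertices of the square inscribed in the unit circle, and let $\omega>0$ be the angular velocity for which the uniform rotation of $z_0$ about the origin is a solution, namely $\omega^2=(2^{-1-\alpha}+2^{-\alpha/2})\alpha$. Then for every $\alpha>0$ the corresponding relative equilibrium is (linearly) unstable: the linearized system at it has an eigenvalue with positive real part.
   Context: A configuration $z=(a_1,\dots,a_n)\in(\mathbb{R}^2)^n$ together with $\omega>0$ defines a relative equilibrium if $q_i(t)=\exp(-\omega Jt)a_i$, where $J=\begin{pmatrix}0&1\\-1&0\end{pmatrix}$ and hence $\exp(-\omega Jt)=\begin{pmatrix}\cos\omega t&-\sin\omega t\\ \sin\omega t&\cos\omega t\end{pmatrix}$, solves the equations of motion. In the rotating coordinates $q_i=\exp(-\omega Jt)x_i$ the equations become $\ddot x_i=2\omega J\dot x_i+\omega^2x_i+\nabla_{x_i}U$ (unit masses), and the relative equilibrium becomes the equilibrium $x=z$. The linearized system at it is $\ddot X=2\omega\mathbf{J}\dot X+\omega^2X+D^2U(z)X$ for $X\in\mathbb{R}^{2n}$, where $\mathbf{J}=\mathrm{diag}(J,\dots,J)$ ($n$ blocks) and $D^2U(z)$ is the Hessian of $U$ at $z$. Its eigenvalues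 are those of the $4n\times4n$ matrix $\begin{pmatrix}0&I_{2n}\\ \omega^2I_{2n}+D^2U(z)&2\omega\mathbf{J}\end{pmatrix}$. The relative equilibrium is called (linearly) unstable if this matrix has an eigenvalue with positive real part. *)

theory Defs
  imports "HOL-Analysis.Analysis"
begin

text \<open>
  A planar configuration of \<open>n = CARD('n)\<close> particles is an element of \<open>real^2^'n\<close>;
  \<open>\<real>\<^sup>2\<^sup>n\<close>, as a space of column vectors, is indexed by pairs (particle, coordinate), i.e. by
  \<open>'n \<times> 2\<close>.
\<close>

definition collision_free :: "real^2^'n \<Rightarrow> bool" where
  "collision_free x \<longleftrightarrow> (\<forall>i j. i \<noteq> j \<longrightarrow> x $ i \<noteq> x $ j)"

definition potential :: "real \<Rightarrow> real^2^('n::{finite,linorder}) \<Rightarrow> real" where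
  "potential \<alpha> x = (\<Sum>(i, j) \<in> {(i, j). i < j}. norm (x $ i - x $ j) powr (-\<alpha>))"

text \<open>
  Unit masses: \<open>q\<close> is a classical solution, for all times, of \<open>q'' = \<nabla>U(q)\<close>.  The \<open>i\<close>-th block of
  the gradient with respect to the inner product of \<open>real^2^'n\<close> is \<open>\<partial>U/\<partial>q\<^sub>i\<close>.
\<close>

definition solves_motion :: "(real^2^'n \<Rightarrow> real) \<Rightarrow> (real \<Rightarrow> real^2^'n) \<Rightarrow> bool" where
  "solves_motion U q \<longleftrightarrow>
     (\<exists>v a. \<forall>t. collision_free (q t) \<and>
              (q has_vector_derivative v t) (at t) \<and>
              (v has_vector_derivative a t) (at t) \<and>
              GDERIV U (q t) :> a t)"

definition Jmat :: "real^2^2" where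
  "Jmat = vector [vector [0, 1], vector [-1, 0]]"

text \<open>\<open>rotation \<theta>\<close> is \<open>exp (-\<theta> J)\<close>, see the two lemmas below.\<close>

definition rotation :: "real \<Rightarrow> real^2^2" where
  "rotation \<theta> = vector [vector [cos \<theta>, - sin \<theta>], vector [sin \<theta>, cos \<theta>]]"

lemma rotation_0: "rotation 0 = mat 1"
  by (simp add: rotation_def vec_eq_iff forall_2 mat_def)

lemma rotation_has_vector_derivative:
  "(rotation has_vector_derivative (- Jmat ** rotation \<theta>)) (at \<theta>)"
proof -
  have entry: "((\<lambda>\<theta>. rotation \<theta> $ i $ j) has_vector_derivative (- Jmat ** rotation \<theta>) $ i $ j) (at \<theta>)" for i j
    using exhaust_2[of i] exhaust_2[of j]
    by (auto simp: rotation_def Jmat_def matrix_matrix_mult_def sum_2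
             simp flip: has_real_derivative_iff_has_vector_derivative intro!: derivative_eq_intros)
  show ?thesis
    unfolding has_vector_derivative_def has_derivative_componentwise_within[where f = rotation]
    using entry by (auto simp: has_vector_derivative_def Basis_vec_def inner_axis)
qed

definition relative_equilibrium ::
    "(real^2^'n \<Rightarrow> real) \<Rightarrow> real \<Rightarrow> real^2^'n \<Rightarrow> bool" where
  "relative_equilibrium U \<omega> z \<longleftrightarrow>
     \<omega> > 0 \<and> solves_motion U (\<lambda>t. \<chi> i. rotation (\<omega> * t) *v (z $ i))"

definition hessian :: "(real^2^'n \<Rightarrow> real) \<Rightarrow> real^2^'n \<Rightarrow> real^('n \<times> 2)^('n \<times> 2)" where
  "hessian U z =
     (\<chi> a b. frechet_derivative
               (\<lambda>x. frechet_derivative U (at x) (axis (fst b) (axis (snd b) 1)))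
               (at z) (axis (fst a) (axis (snd a) 1)))"

definition Jblock :: "real^('n::finite \<times> 2)^('n \<times> 2)" where
  "Jblock = (\<chi> a b. if fst a = fst b then Jmat $ snd a $ snd b else 0)"

definition block_matrix ::
    "'a^('n::finite)^('m::finite) \<Rightarrow> 'a^('k::finite)^'m \<Rightarrow> 'a^'n^('l::finite) \<Rightarrow> 'a^'k^'l \<Rightarrow> 'a^('n + 'k)^('m + 'l)" where
  "block_matrix A B C D =
     (\<chi> r c. case r of
        Inl i \<Rightarrow> (case c of Inl j \<Rightarrow> A $ i $ j | Inr j \<Rightarrow> B $ i $ j)
      | Inr i \<Rightarrow> (case c of Inl j \<Rightarrow> C $ i $ j | Inr j \<Rightarrow> D $ i $ j))"

definition linearization ::
    "(real^2^'n \<Rightarrow> real) \<Rightarrow> real \<Rightarrow> real^2^'n \<Rightarrow> real^(('n \<times> 2) + ('n \<times> 2))^(('n \<times> 2) + ('n \<times> 2))" where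
  "linearization U \<omega> z =
     block_matrix 0 (mat 1) (\<omega>\<^sup>2 *\<^sub>R mat 1 + hessian U z) ((2 * \<omega>) *\<^sub>R Jblock)"

definition eigenvalue :: "'a::field^'m^'m \<Rightarrow> 'a \<Rightarrow> bool" where
  "eigenvalue A \<mu> \<longleftrightarrow> (\<exists>v. v \<noteq> 0 \<and> A *v v = \<mu> *s v)"

definition linearly_unstable :: "(real^2^'n \<Rightarrow> real) \<Rightarrow> real \<Rightarrow> real^2^'n \<Rightarrow> bool" where
  "linearly_unstable U \<omega> z \<longleftrightarrow>
     (\<exists>\<mu>. eigenvalue (map_matrix complex_of_real (linearization U \<omega> z)) \<mu> \<and> Re \<mu> > 0)"

definition square :: "real^2^4" where
  "square = vector [vector [1, 0], vector [0, 1], vector [-1, 0], vector [0, -1]]"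

text \<open>In the numeral type \<open>4\<close> the index \<open>4\<close> is \<open>0\<close>, so the four indices below are exhaustive.\<close>

lemma square_nth:
  "square $ 1 = vector [1, 0]" "square $ 2 = vector [0, 1]"
  "square $ 3 = vector [-1, 0]" "square $ 4 = vector [0, -1]"
  by (simp_all add: square_def vector_def)

end

theory Submission
  imports Defs
begin

text \<open>
  The gradient of the potential is rotation equivariant and equals \<open>-\<omega>\<^sup>2 z\<close> at the square \<open>z\<close>, which
  determines the angular velocity.  For instability, displace the particles alternately by \<open>e\<close> and
  \<open>-e\<close>: for every \<open>e \<in> \<real>\<^sup>2\<close> this is an eigenvector of the Hessian with the eigenvalue
  \<open>c = \<alpha>\<^sup>2 2\<^bsup>-\<alpha>/2\<^esup> > 0\<close>.  Over the complex numbers \<open>e = (1, -\<i>)\<close> is moreover an eigenvector of \<open>J\<close> with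
  eigenvalue \<open>-\<i>\<close>, so that the linearized system reduces to \<open>\<mu>\<^sup>2 = -2 \<i> \<omega> \<mu> + \<omega>\<^sup>2 + c\<close>, that is
  \<open>(\<mu> + \<i> \<omega>)\<^sup>2 = c\<close>, and \<open>\<mu> = sqrt c - \<i> \<omega>\<close> is an eigenvalue.
\<close>

section \<open>The interaction of one pair\<close>

text \<open>For \<open>d \<noteq> 0\<close> this is the gradient of
  \<open>norm d powr (-\<alpha>)\<close>, and \<open>pair_hessian \<alpha> d\<close> is the second
  derivative acting on a relative displacement. Both vanish at \<open>d = 0\<close>.\<close>

definition pair_force :: "real \<Rightarrow> 'a::real_inner \<Rightarrow> 'a" where
  "pair_force \<alpha> d = (- \<alpha> * norm d powr (- \<alpha> - 2)) *\<^sub>R d"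

definition pair_hessian :: "real \<Rightarrow> 'a::real_inner \<Rightarrow> 'a \<Rightarrow> 'a" where
  "pair_hessian \<alpha> d h =
     (- \<alpha> * norm d powr (- \<alpha> - 2)) *\<^sub>R h + (\<alpha> * (\<alpha> + 2) * norm d powr (- \<alpha> - 4) * (d \<bullet> h)) *\<^sub>R d"

text \<open>The terms with \<open>j = i\<close> vanish in both sums.\<close>

definition total_force :: "real \<Rightarrow> real^2^'n \<Rightarrow> real^2^'n" where
  "total_force \<alpha> x = (\<chi> i. \<Sum>j\<in>UNIV. pair_force \<alpha> (x $ i - x $ j))"

definition total_hessian :: "real \<Rightarrow> real^2^'n \<Rightarrow> real^2^'n \<Rightarrow> real^2^'n" where
  "total_hessian \<alpha> x h = (\<chi> i. \<Sum>j\<in>UNIV. pair_hessian \<alpha> (x $ i - x $ j) (h $ i - h $ j))"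

lemma has_derivative_norm_powr:
  fixes x :: "'a::real_inner"
  assumes "x \<noteq> 0"
  shows "((\<lambda>x. norm x powr p) has_derivative (\<lambda>h. p * norm x powr (p - 2) * (x \<bullet> h))) (at x)"
proof -
  have "((\<lambda>r. r powr p) has_derivative (\<lambda>h. (p * norm x powr (p - 1)) * h)) (at (norm x))"
    using has_real_derivative_powr[of "norm x" p] assms by (simp add: has_field_derivative_def)
  from has_derivative_compose[OF has_derivative_norm[OF assms] this]
  have "((\<lambda>x. norm x powr p) has_derivative (\<lambda>h. (p * norm x powr (p - 1)) * (h \<bullet> sgn x))) (at x)" .
  \<comment> \<open>One factor \<open>norm x\<close> is split off to cancel the denominator of
    \<open>sgn x\<close>.\<close>
  moreover have "norm x powr (p - 1) = norm x powr (p - 2) * norm x"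
    using assms powr_add[of "norm x" "p - 2" 1] by simp
  ultimately show ?thesis
    using assms by (simp add: sgn_div_norm inner_commute[of x] field_simps)
qed

lemma pair_force_has_derivative:
  fixes d :: "'a::real_inner"
  assumes "d \<noteq> 0"
  shows "(pair_force \<alpha> has_derivative pair_hessian \<alpha> d) (at d)"
proof -
  have "((\<lambda>x. norm x powr (- \<alpha> - 2)) has_derivative
         (\<lambda>h. (- \<alpha> - 2) * norm d powr (- \<alpha> - 4) * (d \<bullet> h))) (at d)"
    using has_derivative_norm_powr[OF assms, of "- \<alpha> - 2"] by (simp add: algebra_simps)
  from has_derivative_scaleR[OF has_derivative_mult_right[OF this, of "- \<alpha>"] has_derivative_ident]
  show ?thesis
    by (simp add: pair_force_def[abs_def] pair_hessian_def[abs_def] algebra_simps)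
qed

lemma pair_force_minus: "pair_force \<alpha> (- d) = - pair_force \<alpha> d"
  by (simp add: pair_force_def)

lemma pair_hessian_minus: "pair_hessian \<alpha> (- d) (- h) = - pair_hessian \<alpha> d h"
  by (simp add: pair_hessian_def)

lemma pair_hessian_symmetric: "pair_hessian \<alpha> d h \<bullet> k = pair_hessian \<alpha> d k \<bullet> h"
  unfolding pair_hessian_def inner_add_left inner_scaleR_left
  by (simp add: inner_commute mult_ac)

section \<open>Gradient and Hessian of the potential\<close>

text \<open>Newton's third law: the diagonal terms are zero, and the terms of \<open>(i, j)\<close>
  and \<open>(j, i)\<close> merge into one with the relative displacement. This links sums over
  particles with the sum over pairs in \<open>potential\<close>.\<close>

lemma sum_antisymmetric_inner:
  fixes g :: "'n::{finite,linorder} \<Rightarrow> 'n \<Rightarrow> 'a::real_inner"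
  assumes g: "\<And>i j. g j i = - g i j"
  shows "(\<Sum>i\<in>UNIV. \<Sum>j\<in>UNIV. g i j \<bullet> k i) = (\<Sum>(i, j)\<in>{(i, j). i < j}. g i j \<bullet> (k i - k j))"
proof -
  let ?L = "{(i, j). i < (j::'n)}" and ?f = "\<lambda>(i, j). g i j \<bullet> k i"
  have diag: "g i i = 0" for i
  proof -
    have "g i i + g i i = 0"
      unfolding eq_neg_iff_add_eq_0[symmetric] by (rule g)
    then show ?thesis
      unfolding scaleR_2[symmetric] by simp
  qed
  have "(\<Sum>i\<in>UNIV. \<Sum>j\<in>UNIV. g i j \<bullet> k i) = sum ?f UNIV"
    by (simp add: sum.cartesian_product)
  also have "\<dots> = sum ?f (?L \<union> prod.swap ` ?L)"
  proof (rule sum.mono_neutral_right)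
    show "\<forall>p\<in>UNIV - (?L \<union> prod.swap ` ?L). ?f p = 0"
    proof
      fix p assume p: "p \<in> UNIV - (?L \<union> prod.swap ` ?L)"
      then have "p \<notin> ?L" "prod.swap p \<notin> ?L"
        by (auto simp: image_iff)
      then have "fst p = snd p"
        by (auto simp: case_prod_beta)
      then show "?f p = 0" by (simp add: case_prod_beta diag)
    qed
  qed auto
  also have "\<dots> = sum ?f ?L + sum ?f (prod.swap ` ?L)"
    by (rule sum.union_disjoint) auto
  also have "sum ?f (prod.swap ` ?L) = (\<Sum>(i, j)\<in>?L. g j i \<bullet> k j)"
    by (subst sum.reindex) (auto simp: inj_on_def case_prod_beta o_def)
  also have "sum ?f ?L + \<dots> = (\<Sum>(i, j)\<in>?L. g i j \<bullet> (k i - k j))"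
  proof -
    have "g j i \<bullet> k j = - (g i j \<bullet> k j)" for i j
      by (subst g) simp
    then show ?thesis
      by (simp add: sum.distrib[symmetric] inner_diff_right case_prod_beta)
  qed
  finally show ?thesis .
qed

lemma potential_GDERIV:
  fixes x :: "real^2^('n::{finite,linorder})"
  assumes "collision_free x"
  shows "GDERIV (potential \<alpha>) x :> total_force \<alpha> x"
proof -
  have pair: "((\<lambda>x. norm (x $ i - x $ j) powr (- \<alpha>)) has_derivative
               (\<lambda>h. pair_force \<alpha> (x $ i - x $ j) \<bullet> (h $ i - h $ j))) (at x)"
    if "i < j" for i j
  proof -
    have "x $ i - x $ j \<noteq> 0"
      using assms that by (auto simp: collision_free_def)
    from has_derivative_norm_powr[OF this]
    have d: "((\<lambda>x. norm x powr (- \<alpha>)) has_derivative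
       (\<lambda>h. - \<alpha> * norm (x $ i - x $ j) powr (- \<alpha> - 2) * ((x $ i - x $ j) \<bullet> h))) (at (x $ i - x $ j))" .
    have "((\<lambda>x. x $ i - x $ j) has_derivative (\<lambda>h. h $ i - h $ j)) (at x)"
      by (intro derivative_intros bounded_linear_imp_has_derivative bounded_linear_vec_nth)
    from has_derivative_compose[OF this d] show ?thesis
      by (simp add: pair_force_def)
  qed
  have "(potential \<alpha> has_derivative
          (\<lambda>h. \<Sum>(i, j)\<in>{(i, j). i < j}. pair_force \<alpha> (x $ i - x $ j) \<bullet> (h $ i - h $ j))) (at x)"
    unfolding potential_def[abs_def] case_prod_beta
    by (rule has_derivative_sum) (use pair in auto)
  \<comment> \<open>Regrouping the pair terms by particle exhibits the derivative as an inner
    product, from which the gradient is read off.\<close>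
  also have "(\<lambda>h. \<Sum>(i, j)\<in>{(i, j). i < j}. pair_force \<alpha> (x $ i - x $ j) \<bullet> (h $ i - h $ j)) =
             (\<lambda>h. h \<bullet> total_force \<alpha> x)"
  proof
    fix h
    have "(\<Sum>(i, j)\<in>{(i, j). i < j}. pair_force \<alpha> (x $ i - x $ j) \<bullet> (h $ i - h $ j)) =
          (\<Sum>i\<in>UNIV. \<Sum>j\<in>UNIV. pair_force \<alpha> (x $ i - x $ j) \<bullet> h $ i)"
      by (rule sum_antisymmetric_inner[symmetric]) (metis minus_diff_eq pair_force_minus)
    then show "(\<Sum>(i, j)\<in>{(i, j). i < j}. pair_force \<alpha> (x $ i - x $ j) \<bullet> (h $ i - h $ j)) =
               h \<bullet> total_force \<alpha> x"
      by (simp add: total_force_def inner_vec_def[of h] inner_sum_right inner_commute)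
  qed
  finally show ?thesis
    by (simp add: gderiv_def)
qed

lemma total_force_has_derivative:
  assumes "collision_free x"
  shows "(total_force \<alpha> has_derivative total_hessian \<alpha> x) (at x)"
proof -
  have pair: "((\<lambda>x. pair_force \<alpha> (x $ i - x $ j)) has_derivative
               (\<lambda>h. pair_hessian \<alpha> (x $ i - x $ j) (h $ i - h $ j))) (at x)" for i j
  proof (cases "i = j")
    case True
    then show ?thesis by (simp add: pair_hessian_def)
  next
    case False
    then have d: "(pair_force \<alpha> has_derivative pair_hessian \<alpha> (x $ i - x $ j)) (at (x $ i - x $ j))"
      using assms by (intro pair_force_has_derivative) (auto simp: collision_free_def)
    have "((\<lambda>x. x $ i - x $ j) has_derivative (\<lambda>h. h $ i - h $ j)) (at x)"
      by (intro derivative_intros bounded_linear_imp_has_derivative bounded_linear_vec_nth)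
    from has_derivative_compose[OF this d] show ?thesis .
  qed
  have i: "((\<lambda>x. total_force \<alpha> x $ i) has_derivative (\<lambda>h. total_hessian \<alpha> x h $ i)) (at x)" for i
    unfolding total_force_def total_hessian_def vec_lambda_beta
    by (rule has_derivative_sum) (rule pair)
  have "((\<lambda>x. total_force \<alpha> x $ i $ k) has_derivative (\<lambda>h. total_hessian \<alpha> x h $ i $ k)) (at x)" for i k
    by (rule bounded_linear.has_derivative[OF bounded_linear_vec_nth i])
  then show ?thesis
    unfolding has_derivative_componentwise_within[where f = "total_force \<alpha>"]
    by (auto simp: Basis_vec_def inner_axis)
qed

text \<open>Written over unordered pairs, the bilinear form is a sum of pair forms, each of them
  symmetric.\<close>

lemma total_hessian_symmetric:
  fixes x :: "real^2^('n::{finite,linorder})"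
  shows "total_hessian \<alpha> x h \<bullet> k = total_hessian \<alpha> x k \<bullet> h"
proof -
  have *: "total_hessian \<alpha> x h \<bullet> k =
      (\<Sum>(i, j)\<in>{(i, j). i < j}. pair_hessian \<alpha> (x $ i - x $ j) (h $ i - h $ j) \<bullet> (k $ i - k $ j))" for h k
  proof -
    have "total_hessian \<alpha> x h \<bullet> k =
      (\<Sum>i\<in>UNIV. \<Sum>j\<in>UNIV. pair_hessian \<alpha> (x $ i - x $ j) (h $ i - h $ j) \<bullet> k $ i)"
      by (simp add: total_hessian_def inner_vec_def[of _ k] inner_sum_left)
    also have "\<dots> = (\<Sum>(i, j)\<in>{(i, j). i < j}.
        pair_hessian \<alpha> (x $ i - x $ j) (h $ i - h $ j) \<bullet> (k $ i - k $ j))"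
      by (rule sum_antisymmetric_inner) (metis minus_diff_eq pair_hessian_minus)
    finally show ?thesis .
  qed
  show ?thesis
    unfolding * by (subst pair_hessian_symmetric) (rule refl)
qed

text \<open>The formula for the first derivative of the potential is available at collision-free
  points only; openness makes it valid near such a point, so that it can be differentiated
  again.\<close>

lemma open_collision_free: "open {x :: real^2^'n. collision_free x}"
proof -
  have "{x :: real^2^'n. collision_free x} = (\<Inter>i. \<Inter>j. {x. i \<noteq> j \<longrightarrow> x $ i \<noteq> x $ j})"
    by (auto simp: collision_free_def)
  also have "open \<dots>"
    by (intro open_INT ballI finite) (auto intro!: open_Collect_imp open_Collect_neq continuous_intros)
  finally show ?thesis .
qed

text \<open>\<open>hessian\<close> differentiates first in the direction of the column index
  \<open>b\<close> and then in that of the row index \<open>a\<close>, so it is \<open>a\<close>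
  that enters as the argument of \<open>total_hessian\<close>.\<close>

lemma hessian_potential_nth:
  fixes x :: "real^2^('n::{finite,linorder})"
  assumes x: "collision_free x"
  shows "hessian (potential \<alpha>) x $ a $ b =
         total_hessian \<alpha> x (axis (fst a) (axis (snd a) 1)) $ fst b $ snd b"
proof -
  have D: "frechet_derivative (potential \<alpha>) (at y) (axis (fst b) (axis (snd b) 1)) =
           total_force \<alpha> y $ fst b $ snd b" if "collision_free y" for y
    using potential_GDERIV[OF that, of \<alpha>]
    by (simp add: gderiv_def frechet_derivative_at[symmetric] inner_axis')
  have "((\<lambda>x. total_force \<alpha> x $ fst b $ snd b) has_derivative
         (\<lambda>h. total_hessian \<alpha> x h $ fst b $ snd b)) (at x)"
    by (intro bounded_linear.has_derivative[OF bounded_linear_vec_nth]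
              total_force_has_derivative x)
  then have "((\<lambda>x. frechet_derivative (potential \<alpha>) (at x) (axis (fst b) (axis (snd b) 1)))
         has_derivative (\<lambda>h. total_hessian \<alpha> x h $ fst b $ snd b)) (at x)"
    by (rule has_derivative_transform_within_open[OF _ open_collision_free]) (use x D in auto)
  then show ?thesis
    by (simp add: hessian_def frechet_derivative_at[symmetric])
qed

text \<open>The entry formula describes the transposed action on \<open>k\<close>; symmetry of
  \<open>total_hessian\<close> turns it into the action itself.\<close>

lemma hessian_potential_mult:
  fixes x :: "real^2^('n::{finite,linorder})"
  assumes x: "collision_free x"
  shows "(\<Sum>b\<in>UNIV. hessian (potential \<alpha>) x $ a $ b * k $ fst b $ snd b) =
         total_hessian \<alpha> x k $ fst a $ snd a"
proof -
  let ?e = "axis (fst a) (axis (snd a) 1) :: real^2^('n::{finite,linorder})"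
  have "(\<Sum>b\<in>UNIV. hessian (potential \<alpha>) x $ a $ b * k $ fst b $ snd b) = total_hessian \<alpha> x ?e \<bullet> k"
    by (simp add: hessian_potential_nth[OF x] inner_vec_def sum.cartesian_product case_prod_beta)
  also have "\<dots> = total_hessian \<alpha> x k \<bullet> ?e"
    by (rule total_hessian_symmetric)
  finally show ?thesis
    by (simp add: inner_axis)
qed

section \<open>Force and Hessian at the square\<close>

lemma collision_free_square: "collision_free square"
  by (auto simp: collision_free_def forall_4 square_nth vec_eq_iff forall_2)

lemma norm_vec2: "norm (x :: real^2) = sqrt ((x $ 1)\<^sup>2 + (x $ 2)\<^sup>2)"
  by (simp add: norm_vec_def L2_set_def sum_2)

lemma sqrt2_powr: "sqrt 2 powr p = 2 powr (p / 2)"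
  by (simp add: powr_half_sqrt[symmetric] powr_powr)

lemma total_force_square:
  "total_force \<alpha> square = (- ((2 powr (-1 - \<alpha>) + 2 powr (-\<alpha> / 2)) * \<alpha>)) *\<^sub>R square"
proof -
  \<comment> \<open>Opposite vertices are at distance 2, adjacent ones at distance
    \<open>sqrt 2\<close>. The two powers are rewritten with the exponents that
    \<open>pair_force\<close> produces at these distances.\<close>
  have 1: "2 powr (-1 - \<alpha>) = 2 * 2 powr (- \<alpha> - 2)"
    using powr_add[of 2 1 "-\<alpha> - 2"] by simp
  have 2: "2 powr (-\<alpha> / 2) = 2 * 2 powr ((- \<alpha> - 2) / 2)"
    using powr_add[of 2 1 "(- \<alpha> - 2) / 2"] by (simp add: field_simps)
  have 4: "sqrt 4 = 2" using real_sqrt_abs[of 2] by simp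
  show ?thesis
    unfolding 1 2
    by (simp add: vec_eq_iff forall_4 forall_2 total_force_def sum_4 pair_force_def norm_vec2
          square_nth 4 sqrt2_powr algebra_simps)
qed

definition alternating :: "'a::ab_group_add^'m \<Rightarrow> 'a^'m^4" where
  "alternating e = vector [e, - e, e, - e]"

lemma alternating_nth:
  "alternating e $ 1 = e" "alternating e $ 2 = - e"
  "alternating e $ 3 = e" "alternating e $ 4 = - e"
  by (simp_all add: alternating_def vector_def)

text \<open>Opposite vertices move together, so only the two neighbours contribute, each with
  relative displacement \<open>2 e\<close> up to sign. The two sides at a vertex are orthogonal and
  of equal length, so the sum of their rank-one terms is a multiple of the identity, and every
  \<open>e\<close> gets the same eigenvalue.\<close>

lemma total_hessian_square_alternating:
  "total_hessian \<alpha> square (alternating e) = (\<alpha>\<^sup>2 * 2 powr (-\<alpha> / 2)) *\<^sub>R alternating e"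
proof -
  have 2: "2 powr (-\<alpha> / 2) = 2 * 2 powr ((- \<alpha> - 2) / 2)"
    using powr_add[of 2 1 "(- \<alpha> - 2) / 2"] by (simp add: field_simps)
  have 3: "2 powr ((-\<alpha> - 4) / 2) = 2 powr ((- \<alpha> - 2) / 2) / 2"
    using powr_diff[of 2 "(- \<alpha> - 2) / 2" 1] by (simp add: field_simps)
  have 4: "sqrt 4 = 2" using real_sqrt_abs[of 2] by simp
  show ?thesis
    unfolding 2
    by (simp add: vec_eq_iff forall_4 forall_2 total_hessian_def sum_4 pair_hessian_def norm_vec2
          square_nth alternating_nth 4 sqrt2_powr 3 inner_vec_def sum_2 algebra_simps power2_eq_square)
qed

section \<open>Rotation equivariance and the angular velocity\<close>

lemma norm_rotation: "norm (rotation \<theta> *v x) = norm x"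
proof -
  have "(cos \<theta> * a - sin \<theta> * b)\<^sup>2 + (sin \<theta> * a + cos \<theta> * b)\<^sup>2 =
        ((sin \<theta>)\<^sup>2 + (cos \<theta>)\<^sup>2) * (a\<^sup>2 + b\<^sup>2)" for a b :: real
    by algebra
  then show ?thesis
    by (simp add: norm_vec2 rotation_def matrix_vector_mult_def sum_2)
qed

lemma pair_force_rotation: "pair_force \<alpha> (rotation \<theta> *v d) = rotation \<theta> *v pair_force \<alpha> d"
  by (simp only: pair_force_def norm_rotation matrix_vector_mult_scaleR)

lemma total_force_rotation:
  "total_force \<alpha> (\<chi> i. rotation \<theta> *v (x $ i)) = (\<chi> i. rotation \<theta> *v (total_force \<alpha> x $ i))"
  by (simp add: total_force_def pair_force_rotation vec.sum
      flip: matrix_vector_mult_diff_distrib)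

lemma collision_free_rotation:
  assumes "collision_free x"
  shows "collision_free (\<chi> i. rotation \<theta> *v (x $ i))"
proof -
  have "rotation \<theta> *v u \<noteq> rotation \<theta> *v w" if "u \<noteq> w" for u w
    using that norm_rotation[of \<theta> "u - w"] by (auto simp: matrix_vector_mult_diff_distrib)
  with assms show ?thesis
    by (simp add: collision_free_def)
qed

text \<open>The left factor \<open>A\<close> allows two uses: \<open>mat 1\<close> yields the
  velocity, and \<open>- (\<omega> *\<^sub>R Jmat)\<close> yields the acceleration.\<close>

lemma rotating_has_vector_derivative:
  fixes A :: "real^2^2"
  shows "((\<lambda>t. \<chi> i. (A ** rotation (\<omega> * t)) *v (x $ i)) has_vector_derivative
    (\<chi> i. (A ** (\<omega> *\<^sub>R (- Jmat ** rotation (\<omega> * t)))) *v (x $ i))) (at t)"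
proof -
  have lin: "bounded_linear (\<lambda>M::real^2^2. \<chi> i. (A ** M) *v (x $ i))"
    unfolding linear_conv_bounded_linear[symmetric]
    by (rule linearI)
      (simp_all add: vec_eq_iff matrix_matrix_mult_def matrix_vector_mult_def sum_2 algebra_simps)
  have "((\<lambda>t. \<omega> * t) has_vector_derivative \<omega>) (at t)"
    by (auto intro!: derivative_eq_intros simp flip: has_real_derivative_iff_has_vector_derivative)
  from vector_diff_chain_at[OF this rotation_has_vector_derivative]
  have "((\<lambda>t. rotation (\<omega> * t)) has_vector_derivative (\<omega> *\<^sub>R (- Jmat ** rotation (\<omega> * t)))) (at t)"
    by (simp add: o_def)
  from bounded_linear.has_vector_derivative[OF lin this] show ?thesis .
qed

lemma rotating_derivatives:
  fixes x :: "real^2^'n"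
  shows "\<exists>v. \<forall>t. ((\<lambda>t. \<chi> i. rotation (\<omega> * t) *v (x $ i)) has_vector_derivative v t) (at t) \<and>
    (v has_vector_derivative (\<chi> i. (- (\<omega>\<^sup>2)) *\<^sub>R (rotation (\<omega> * t) *v (x $ i)))) (at t)"
proof -
  define A where "A = - (\<omega> *\<^sub>R Jmat)"
  have A: "\<omega> *\<^sub>R (- Jmat ** M) = A ** M" for M :: "real^2^2"
    by (simp add: A_def vec_eq_iff matrix_matrix_mult_def sum_distrib_left sum_negf mult_ac)
  \<comment> \<open>\<open>A\<close> is the generator of the rotation, and the square of
    \<open>Jmat\<close> is minus the identity.\<close>
  have AA: "(A ** (A ** M)) *v y = (- (\<omega>\<^sup>2)) *\<^sub>R (M *v y)" for M :: "real^2^2" and y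
    by (simp add: A_def Jmat_def vec_eq_iff forall_2 matrix_matrix_mult_def matrix_vector_mult_def
          sum_2 power2_eq_square algebra_simps)
  show ?thesis
    using rotating_has_vector_derivative[of "mat 1" \<omega> x] rotating_has_vector_derivative[of A \<omega> x]
    unfolding A AA by (intro exI[of _ "\<lambda>t. \<chi> i. (A ** rotation (\<omega> * t)) *v (x $ i)"]) auto
qed

text \<open>Uniform rotation has acceleration \<open>- (\<omega>\<^sup>2) *\<^sub>R q t\<close>,
  while the force along it is \<open>- c *\<^sub>R q t\<close>; the equation of motion compares the
  two factors.\<close>

lemma relative_equilibrium_square_iff:
  "relative_equilibrium (potential \<alpha>) \<omega> square \<longleftrightarrow>
   \<omega> > 0 \<and> \<omega>\<^sup>2 = (2 powr (-1 - \<alpha>) + 2 powr (-\<alpha> / 2)) * \<alpha>"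
proof -
  define c where "c = (2 powr (-1 - \<alpha>) + 2 powr (-\<alpha> / 2)) * \<alpha>"
  define q where "q = (\<lambda>t. \<chi> i. rotation (\<omega> * t) *v (square $ i))"
  have free: "collision_free (q t)" for t
    unfolding q_def by (intro collision_free_rotation collision_free_square)
  have "total_force \<alpha> (q t) = - c *\<^sub>R q t" for t
    unfolding q_def total_force_rotation total_force_square c_def[symmetric] vector_scaleR_component
      matrix_vector_mult_scaleR by (simp add: vec_eq_iff)
  with potential_GDERIV[OF free, of \<alpha>]
  have grad: "GDERIV (potential \<alpha>) (q t) :> - c *\<^sub>R q t" for t
    by simp
  obtain v where v: "\<And>t. (q has_vector_derivative v t) (at t)"
      "\<And>t. (v has_vector_derivative - (\<omega>\<^sup>2) *\<^sub>R q t) (at t)"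
  proof -
    have "(\<chi> i. - (\<omega>\<^sup>2) *\<^sub>R (rotation (\<omega> * t) *v (square $ i))) = - (\<omega>\<^sup>2) *\<^sub>R q t" for t
      by (simp add: q_def vec_eq_iff)
    then show ?thesis
      using rotating_derivatives[of \<omega> square] that unfolding q_def[symmetric] by auto
  qed
  have "solves_motion (potential \<alpha>) q \<longleftrightarrow> \<omega>\<^sup>2 = c"
  proof
    assume "solves_motion (potential \<alpha>) q"
    then obtain v' a where s: "\<And>t. (q has_vector_derivative v' t) (at t)"
        "\<And>t. (v' has_vector_derivative a t) (at t)" "\<And>t. GDERIV (potential \<alpha>) (q t) :> a t"
      unfolding solves_motion_def by blast
    \<comment> \<open>\<open>solves_motion\<close> only asserts that some velocity and acceleration
      exist; uniqueness of derivatives identifies them with the computed ones.\<close>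
    have "v' = v"
      using s(1) v(1) vector_derivative_unique_at by blast
    then have "a 0 = - (\<omega>\<^sup>2) *\<^sub>R q 0"
      using s(2) v(2) vector_derivative_unique_at by blast
    moreover have "a 0 = - c *\<^sub>R q 0"
    proof -
      have "(\<lambda>h. h \<bullet> a 0) = (\<lambda>h. h \<bullet> (- c *\<^sub>R q 0))"
        using s(3)[of 0] grad[of 0] unfolding gderiv_def by (rule has_derivative_unique)
      then show ?thesis
        by (metis vector_eq_ldot)
    qed
    ultimately have "\<omega>\<^sup>2 *\<^sub>R q 0 = c *\<^sub>R q 0"
      by (metis neg_equal_iff_equal scaleR_minus_left)
    moreover have "q 0 \<noteq> 0"
      by (auto simp: q_def rotation_0 vec_eq_iff square_nth intro!: exI[of _ 1])
    ultimately show "\<omega>\<^sup>2 = c"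
      by (metis scaleR_cancel_right)
  next
    assume "\<omega>\<^sup>2 = c"
    then show "solves_motion (potential \<alpha>) q"
      unfolding solves_motion_def using free grad v
      by (intro exI[of _ v] exI[of _ "\<lambda>t. - c *\<^sub>R q t"]) simp
  qed
  then show ?thesis
    by (simp add: relative_equilibrium_def q_def c_def)
qed

section \<open>The unstable eigenvalue\<close>

lemma sum_UNIV_sum:
  "(\<Sum>r\<in>UNIV. f r) = (\<Sum>a\<in>UNIV. f (Inl a)) + (\<Sum>b\<in>UNIV. f (Inr b))"
  for f :: "'a::finite + 'b::finite \<Rightarrow> 'c::comm_monoid_add"
  unfolding UNIV_Plus_UNIV[symmetric] by (subst sum.Plus) auto

lemma linearly_unstable_square:
  assumes "\<alpha> > 0"
  shows "linearly_unstable (potential \<alpha>) \<omega> square"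
proof -
  define c where "c = \<alpha>\<^sup>2 * 2 powr (-\<alpha> / 2)"
  have c: "c > 0"
    using assms by (simp add: c_def)
  define \<mu> where "\<mu> = complex_of_real (sqrt c) - \<i> * complex_of_real \<omega>"
  have "(complex_of_real (sqrt c))\<^sup>2 = complex_of_real c"
    using c by (simp flip: of_real_power)
  then have \<mu>: "\<mu> * \<mu> = complex_of_real (\<omega>\<^sup>2 + c) - 2 * \<i> * complex_of_real \<omega> * \<mu>"
    by (simp add: \<mu>_def algebra_simps power2_eq_square)
  define H where "H = hessian (potential \<alpha>) square"
  define e where "e = (\<lambda>k. alternating (axis k (1::real)) :: real^2^4)"
  \<comment> \<open>The alternating displacement by \<open>(1, -\<i>)\<close>, assembled from two
    real displacements so that the real Hessian computation applies to each part.\<close>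
  define X where "X = (\<lambda>b. complex_of_real (e 1 $ fst b $ snd b) - \<i> * complex_of_real (e 2 $ fst b $ snd b))"
  have HX: "(\<Sum>b\<in>UNIV. complex_of_real (H $ a $ b) * X b) = c * X a" for a
  proof -
    have "(\<Sum>b\<in>UNIV. H $ a $ b * e k $ fst b $ snd b) = c * e k $ fst a $ snd a" for k
      unfolding H_def hessian_potential_mult[OF collision_free_square] e_def
        total_hessian_square_alternating c_def by simp
    from this[symmetric] show ?thesis
      by (simp add: X_def right_diff_distrib sum_subtractf sum_distrib_left mult_ac
          flip: of_real_mult of_real_sum)
         (simp add: sum_distrib_left mult_ac)
  qed
  have JX: "(\<Sum>b\<in>UNIV. complex_of_real (Jblock $ a $ b) * X b) = - \<i> * X a" for a
  proof -
    have "(\<Sum>b\<in>UNIV. complex_of_real (Jblock $ a $ b) * X b) =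
          (\<Sum>i\<in>UNIV. \<Sum>k\<in>UNIV. complex_of_real (Jblock $ a $ (i, k)) * X (i, k))"
      by (simp add: sum.cartesian_product case_prod_beta)
    also have "\<dots> = - \<i> * X a"
      using exhaust_4[of "fst a"] exhaust_2[of "snd a"]
      by (cases a) (auto simp: sum_4 sum_2 Jblock_def Jmat_def X_def e_def alternating_nth axis_def)
    finally show ?thesis .
  qed
  \<comment> \<open>For a first-order system in position and velocity, an eigenvector has the form
    \<open>(X, \<mu> X)\<close>: the upper block then holds at once, and the lower block is the
    second-order equation.\<close>
  define V where "V = (\<chi> r. case r of Inl b \<Rightarrow> X b | Inr b \<Rightarrow> \<mu> * X b)"
  have "map_matrix complex_of_real (linearization (potential \<alpha>) \<omega> square) *v V = \<mu> *s V"
    unfolding vec_eq_iff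
  proof
    fix r
    show "(map_matrix complex_of_real (linearization (potential \<alpha>) \<omega> square) *v V) $ r = (\<mu> *s V) $ r"
    proof (cases r)
      case (Inl a)
      then show ?thesis
        by (simp add: matrix_vector_mult_def linearization_def block_matrix_def sum_UNIV_sum V_def
            mat_def if_distrib[of complex_of_real] if_distrib[of "\<lambda>x. x * _"] cong: if_cong)
    next
      case (Inr a)
      have "(map_matrix complex_of_real (linearization (potential \<alpha>) \<omega> square) *v V) $ r =
         (\<Sum>b\<in>UNIV. complex_of_real (\<omega>\<^sup>2) * (if a = b then X b else 0)
                      + complex_of_real (H $ a $ b) * X b) +
         (\<Sum>b\<in>UNIV. (2 * complex_of_real \<omega> * \<mu>) * (complex_of_real (Jblock $ a $ b) * X b))"
        unfolding Inr matrix_vector_mult_def vec_lambda_beta sum_UNIV_sum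
        by (intro arg_cong2[of _ _ _ _ "(+)"] sum.cong refl)
           (simp_all add: linearization_def block_matrix_def V_def mat_def H_def algebra_simps)
      also have "\<dots> = complex_of_real (\<omega>\<^sup>2) * X a + c * X a + (2 * complex_of_real \<omega> * \<mu>) * (- \<i> * X a)"
        unfolding sum.distrib sum_distrib_left[symmetric] HX JX by simp
      \<comment> \<open>This is the quadratic equation satisfied by \<open>\<mu>\<close>.\<close>
      also have "\<dots> = (\<mu> * \<mu>) * X a"
        unfolding \<mu> by (simp add: algebra_simps)
      also have "\<dots> = (\<mu> *s V) $ r"
        by (simp add: Inr V_def)
      finally show ?thesis .
    qed
  qed
  moreover have "V \<noteq> 0"
  proof
    assume "V = 0"
    \<comment> \<open>The first coordinate of the first particle in \<open>X\<close> equals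
      1.\<close>
    then have "V $ Inl (1, 1) = 0" by simp
    then show False by (simp add: V_def X_def e_def alternating_nth axis_def)
  qed
  moreover have "Re \<mu> > 0"
    using c by (simp add: \<mu>_def)
  ultimately show ?thesis
    unfolding linearly_unstable_def eigenvalue_def by blast
qed

theorem mainTheorem2:
  fixes \<alpha> \<omega> :: real
  assumes "\<alpha> > 0"
    and "\<omega> > 0"
    and "\<omega>\<^sup>2 = (2 powr (-1 - \<alpha>) + 2 powr (-\<alpha> / 2)) * \<alpha>"
  shows "(\<forall>\<omega>'. relative_equilibrium (potential \<alpha>) \<omega>' square \<longleftrightarrow> \<omega>' = \<omega>) \<and>
         linearly_unstable (potential \<alpha>) \<omega> square"
  \<comment> \<open>Positive numbers with equal squares coincide, so \<open>\<omega>\<close> is the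
    only admissible angular velocity.\<close>
  using assms linearly_unstable_square[OF assms(1), of \<omega>]
  by (auto simp: relative_equilibrium_square_iff intro: power2_eq_imp_eq)

end
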